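(* Let $\kappa>\aleph_1$ be a regular cardinal. If $\mathsf{CP}(\kappa,\omega)$ holds, then $\square(\kappa)$ fails.
   Context: $\square(\kappa)$ asserts the existence of a sequence $(C_\alpha:\alpha<\kappa)$ such that: for every limit $\alpha$, $C_\alpha$ is a club subset of $\alpha$; if $\alpha$ is a limit point of $C_\beta$ then $C_\alpha=C_\beta\cap\alpha$; $C_{\beta+1}=\{\beta\}$; and there is no club $C\subseteq\kappa$ such that for all $\alpha$ there is $\beta\geq\alpha$ with $C\cap\alpha=C_\beta$. An $\omega$-covering matrix for regular $\kappa>\omega$ is a family $(K(n,\beta):n<\omega,\ \beta<\kappa)$ of subsets of $\kappa$ such that: (i) $\beta\subseteq\bigcup_n K(n,\beta)$; (ii) $|K(n,\beta)|<\kappa$; (iii) $K(n,\beta)\subseteq K(m,\beta)$ for $n<m$; (iv) for all $\gamma<\beta<\kappa$ and $n$ there is $m$ with $K(n,\gamma)\subseteq K(m,\beta)$; (v) for every countable $X\subseteq\kappa$ there is $\gamma_X<\kappa$ such that for all $\beta<\kappa$ and $m$ there is $n$ with $K(m,\beta)\cap X\subseteq K(n,\gamma_X)$. $\mathsf{CP}(\kappa,\omega)$: for every $\omega$-covering matrix for $\kappa$ there is an unbounded $A\subseteq\kappa$ such that every countably infinite subset of $A$ is contained in some $K(n,\beta)$.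
   Formalization: The last clause of □(κ) is taken as "C∩α = C_β∩α" instead of the printed "C∩α = C_β"; as printed no club could satisfy it, so □(κ) would hold for every regular uncountable κ. *)

theory Defs
  imports Main "HOL-Library.Countable_Set"
begin

unbundle cardinal_syntax

text \<open>
  The cardinal \<open>\<kappa>\<close> is a relation satisfying \<^const>\<open>Card_order\<close>, and the ordinals below \<open>\<kappa>\<close> are
  the elements of \<open>Field \<kappa>\<close>. As a set of smaller ordinals, \<open>\<alpha>\<close> is \<open>underS \<kappa> \<alpha>\<close>, and
  \<open>\<kappa>\<close> itself is \<open>Field \<kappa>\<close>; the argument \<open>S\<close> below is one of these two sets.
\<close>

definition unbounded_in :: "'a rel \<Rightarrow> 'a set \<Rightarrow> 'a set \<Rightarrow> bool" where
  "unbounded_in \<kappa> S C \<longleftrightarrow> (\<forall>\<gamma>\<in>S. \<exists>\<delta>\<in>C \<inter> S. \<gamma> \<in> underS \<kappa> \<delta>)"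

definition limit_ordinal :: "'a rel \<Rightarrow> 'a \<Rightarrow> bool" where
  "limit_ordinal \<kappa> \<alpha> \<longleftrightarrow>
     \<alpha> \<in> Field \<kappa> \<and> underS \<kappa> \<alpha> \<noteq> {} \<and> (\<forall>\<beta>\<in>Field \<kappa>. \<alpha> \<noteq> wo_rel.suc \<kappa> {\<beta>})"

text \<open>\<open>\<alpha>\<close> is a nonzero ordinal with \<open>sup (C \<inter> \<alpha>) = \<alpha>\<close>, the supremum not being attained.\<close>

definition limit_point :: "'a rel \<Rightarrow> 'a set \<Rightarrow> 'a \<Rightarrow> bool" where
  "limit_point \<kappa> C \<alpha> \<longleftrightarrow>
     \<alpha> \<in> Field \<kappa> \<and> underS \<kappa> \<alpha> \<noteq> {} \<and> unbounded_in \<kappa> (underS \<kappa> \<alpha>) C"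

definition club_in :: "'a rel \<Rightarrow> 'a set \<Rightarrow> 'a set \<Rightarrow> bool" where
  "club_in \<kappa> S C \<longleftrightarrow>
     C \<subseteq> S \<and> unbounded_in \<kappa> S C \<and> (\<forall>\<alpha>\<in>S. limit_point \<kappa> C \<alpha> \<longrightarrow> \<alpha> \<in> C)"

text \<open>
  In the last clause \<open>D \<inter> \<alpha>\<close> is compared with \<open>C \<beta> \<inter> \<alpha>\<close>. Comparing it with \<open>C \<beta>\<close>, as is sometimes
  printed, would make the clause redundant: by the other clauses, for successor \<open>\<alpha> = \<delta> + 1\<close> and
  \<open>\<beta> \<ge> \<alpha>\<close>, the equation \<open>D \<inter> \<alpha> = C \<beta>\<close> forces \<open>D \<inter> \<alpha> = {\<delta>}\<close>, which cannot hold for all \<open>\<delta>\<close>.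
  Given the other clauses, the clause below says that no club \<open>D\<close> satisfies \<open>D \<inter> \<alpha> = C \<alpha>\<close> at
  all its limit points \<open>\<alpha>\<close>. The set \<open>C 0\<close> is not constrained; replacing it by the empty
  set preserves all the clauses.
\<close>

definition square_sequence :: "'a rel \<Rightarrow> ('a \<Rightarrow> 'a set) \<Rightarrow> bool" where
  "square_sequence \<kappa> C \<longleftrightarrow>
     (\<forall>\<alpha>. limit_ordinal \<kappa> \<alpha> \<longrightarrow> club_in \<kappa> (underS \<kappa> \<alpha>) (C \<alpha>)) \<and>
     (\<forall>\<alpha>\<in>Field \<kappa>. \<forall>\<beta>\<in>Field \<kappa>. limit_point \<kappa> (C \<beta>) \<alpha> \<longrightarrow> C \<alpha> = C \<beta> \<inter> underS \<kappa> \<alpha>) \<and>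
     (\<forall>\<beta>\<in>Field \<kappa>. C (wo_rel.suc \<kappa> {\<beta>}) = {\<beta>}) \<and>
     \<not> (\<exists>D. club_in \<kappa> (Field \<kappa>) D \<and>
            (\<forall>\<alpha>\<in>Field \<kappa>. \<exists>\<beta>\<in>Field \<kappa>. (\<alpha>, \<beta>) \<in> \<kappa> \<and>
               D \<inter> underS \<kappa> \<alpha> = C \<beta> \<inter> underS \<kappa> \<alpha>))"

definition square :: "'a rel \<Rightarrow> bool" where
  "square \<kappa> \<longleftrightarrow> (\<exists>C. square_sequence \<kappa> C)"

definition omega_covering_matrix :: "'a rel \<Rightarrow> (nat \<Rightarrow> 'a \<Rightarrow> 'a set) \<Rightarrow> bool" where
  "omega_covering_matrix \<kappa> K \<longleftrightarrow>
     (\<forall>n. \<forall>\<beta>\<in>Field \<kappa>. K n \<beta> \<subseteq> Field \<kappa>) \<and>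
     (\<forall>\<beta>\<in>Field \<kappa>. underS \<kappa> \<beta> \<subseteq> (\<Union>n. K n \<beta>)) \<and>
     (\<forall>n. \<forall>\<beta>\<in>Field \<kappa>. |K n \<beta>| <o \<kappa>) \<and>
     (\<forall>\<beta>\<in>Field \<kappa>. \<forall>n m. n < m \<longrightarrow> K n \<beta> \<subseteq> K m \<beta>) \<and>
     (\<forall>\<beta>\<in>Field \<kappa>. \<forall>\<gamma>\<in>underS \<kappa> \<beta>. \<forall>n. \<exists>m. K n \<gamma> \<subseteq> K m \<beta>) \<and>
     (\<forall>X. X \<subseteq> Field \<kappa> \<and> countable X \<longrightarrow>
        (\<exists>\<gamma>\<in>Field \<kappa>. \<forall>\<beta>\<in>Field \<kappa>. \<forall>m. \<exists>n. K m \<beta> \<inter> X \<subseteq> K n \<gamma>))"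

definition CP_omega :: "'a rel \<Rightarrow> bool" where
  "CP_omega \<kappa> \<longleftrightarrow>
     (\<forall>K. omega_covering_matrix \<kappa> K \<longrightarrow>
        (\<exists>A. A \<subseteq> Field \<kappa> \<and> unbounded_in \<kappa> (Field \<kappa>) A \<and>
             (\<forall>X. X \<subseteq> A \<and> countable X \<and> infinite X \<longrightarrow>
                (\<exists>n. \<exists>\<beta>\<in>Field \<kappa>. X \<subseteq> K n \<beta>))))"

end

theory Submission
  imports Defs "HOL-Library.Countable_Set_Type"
begin

text \<open>
  Let \<open>\<rho> \<alpha> \<beta>\<close> be the number of steps of Todorcevic's walk from \<open>\<beta>\<close> down to \<open>\<alpha>\<close> along a
  \<open>\<square>(\<kappa>)\<close>-sequence \<open>C\<close>, the step from \<open>\<beta>\<close> leading to \<open>min (C \<beta> - \<alpha>)\<close>. Coherence of \<open>C\<close> makes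
  \<open>\<rho> \<cdot> \<alpha>\<close> and \<open>\<rho> \<cdot> \<beta>\<close> differ by a bounded amount below \<open>\<alpha> < \<beta>\<close>, hence the sets
  \<open>K n \<beta> = {\<alpha> < \<beta>. \<rho> \<alpha> \<beta> \<le> n}\<close> form a covering matrix. If \<open>A\<close> is given by \<open>CP\<close> for this matrix, then
  every \<open>A \<inter> \<beta>\<close> is contained in a single \<open>K n \<beta>\<close>, so some \<open>n\<close> works cofinally often. This is
  impossible by induction on \<open>n\<close>: either a pressing down argument removes the first step of
  cofinally many walks, which decreases \<open>n\<close>, or cofinally many of the \<open>C \<delta>\<close> are initial segments of
  one another, and their union is a club forbidden by \<open>\<square>(\<kappa>)\<close>.
\<close>

section \<open>Strict well-orders of uncountable cofinality\<close>

locale uncountable_cofinality =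
  fixes F :: "'a set" and lt :: "'a \<Rightarrow> 'a \<Rightarrow> bool" (infix \<open>\<prec>\<close> 50)
  assumes lt_F: "x \<prec> y \<Longrightarrow> x \<in> F \<and> y \<in> F"
    and irr: "\<not> x \<prec> x"
    and tr: "x \<prec> y \<Longrightarrow> y \<prec> z \<Longrightarrow> x \<prec> z"
    and tot: "x \<in> F \<Longrightarrow> y \<in> F \<Longrightarrow> x \<prec> y \<or> x = y \<or> y \<prec> x"
    and wf_lt: "wf {(x, y). x \<prec> y}"
    and countable_bounded: "X \<subseteq> F \<Longrightarrow> countable X \<Longrightarrow> \<exists>y\<in>F. \<forall>x\<in>X. x \<prec> y"
begin

definition le :: "'a \<Rightarrow> 'a \<Rightarrow> bool" (infix \<open>\<preceq>\<close> 50) where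
  "x \<preceq> y \<longleftrightarrow> x = y \<or> x \<prec> y"

definition limpt :: "'a set \<Rightarrow> 'a \<Rightarrow> bool" where
  "limpt S a \<longleftrightarrow> (\<exists>x. x \<prec> a) \<and> (\<forall>x. x \<prec> a \<longrightarrow> (\<exists>d\<in>S. x \<prec> d \<and> d \<prec> a))"

lemma not_lt: "x \<in> F \<Longrightarrow> y \<in> F \<Longrightarrow> \<not> x \<prec> y \<longleftrightarrow> y \<preceq> x"
  unfolding le_def using tot irr tr by blast

lemma le_lt_trans: "x \<preceq> y \<Longrightarrow> y \<prec> z \<Longrightarrow> x \<prec> z"
  unfolding le_def using tr by blast

lemma lt_le_trans: "x \<prec> y \<Longrightarrow> y \<preceq> z \<Longrightarrow> x \<prec> z"
  unfolding le_def using tr by blast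

lemma le_antisym: "x \<preceq> y \<Longrightarrow> y \<preceq> x \<Longrightarrow> x = y"
  unfolding le_def using tr irr by blast

lemma lt_not_le: "x \<prec> y \<Longrightarrow> \<not> y \<preceq> x"
  unfolding le_def using tr irr by blast

lemma ex_least:
  assumes "S \<subseteq> F" "x \<in> S"
  shows "\<exists>z\<in>S. \<forall>y\<in>S. z \<preceq> y"
proof -
  obtain z where z: "z \<in> S" "\<And>y. (y, z) \<in> {(x, y). x \<prec> y} \<Longrightarrow> y \<notin> S"
    using wfE_min[OF wf_lt assms(2)] by blast
  then show ?thesis using not_lt assms(1) by blast
qed

lemma ex_common_bound:
  assumes "x \<in> F" "y \<in> F"
  shows "\<exists>z\<in>F. x \<prec> z \<and> y \<prec> z"
  using countable_bounded[of "{x, y}"] assms by auto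

lemma lt_induct [consumes 1, case_names less]:
  assumes "a \<in> F" and "\<And>b. b \<in> F \<Longrightarrow> (\<And>c. c \<prec> b \<Longrightarrow> P c) \<Longrightarrow> P b"
  shows "P a"
proof -
  have "a \<in> F \<longrightarrow> P a"
    by (induction a rule: wf_induct_rule[OF wf_lt]) (use assms(2) lt_F in blast)
  then show ?thesis using assms(1) by blast
qed

text \<open>A weak form of Fodor's lemma, for regressive functions on a final segment.\<close>

lemma pressing_down:
  assumes \<delta>0: "\<delta>0 \<in> F" and regr: "\<And>\<delta>. \<delta>0 \<prec> \<delta> \<Longrightarrow> f \<delta> \<prec> \<delta>"
  shows "\<exists>\<eta>\<in>F. \<forall>\<zeta>\<in>F. \<exists>\<delta>. \<zeta> \<prec> \<delta> \<and> \<delta>0 \<prec> \<delta> \<and> f \<delta> \<prec> \<eta>"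
proof (rule ccontr)
  assume "\<not> ?thesis"
  then have "\<forall>\<eta>\<in>F. \<exists>\<zeta>. \<zeta> \<in> F \<and> (\<forall>\<delta>. \<zeta> \<prec> \<delta> \<and> \<delta>0 \<prec> \<delta> \<longrightarrow> \<not> f \<delta> \<prec> \<eta>)"
    by blast
  then obtain g where g: "\<And>\<eta>. \<eta> \<in> F \<Longrightarrow> g \<eta> \<in> F"
    "\<And>\<eta> \<delta>. \<eta> \<in> F \<Longrightarrow> g \<eta> \<prec> \<delta> \<Longrightarrow> \<delta>0 \<prec> \<delta> \<Longrightarrow> \<not> f \<delta> \<prec> \<eta>"
    by metis
  \<comment> \<open>Iterating \<open>h\<close> from \<open>\<delta>0\<close> gives an increasing
    sequence \<open>d\<close> whose supremum \<open>s\<close> is closed under \<open>g\<close> along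
    the sequence: \<open>g (d k)\<close> lies below \<open>d (Suc k)\<close>.\<close>
  have "\<forall>x\<in>F. \<exists>y. x \<prec> y \<and> g x \<prec> y"
    using ex_common_bound g(1) by blast
  then obtain h where h: "\<And>x. x \<in> F \<Longrightarrow> x \<prec> h x" "\<And>x. x \<in> F \<Longrightarrow> g x \<prec> h x"
    by metis
  define d where "d k = (h ^^ k) \<delta>0" for k
  have d0: "d 0 = \<delta>0" and dS: "d (Suc k) = h (d k)" for k
    by (simp_all add: d_def)
  have dF: "d k \<in> F" for k
    by (induction k) (use d0 dS \<delta>0 h(1) lt_F in force)+
  let ?U = "{y \<in> F. \<forall>k. d k \<prec> y}"
  have "\<exists>y\<in>F. \<forall>x\<in>range d. x \<prec> y"
    by (rule countable_bounded) (use dF in auto)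
  then obtain y where "y \<in> ?U" by auto
  then obtain s where s: "s \<in> ?U" "\<And>y. y \<in> ?U \<Longrightarrow> s \<preceq> y"
    using ex_least[of ?U y] by blast
  then have "\<delta>0 \<prec> s" using d0 by (metis (mono_tags, lifting) mem_Collect_eq)
  then have fs: "f s \<prec> s" by (rule regr)
  then have fF: "f s \<in> F" using lt_F by blast
  \<comment> \<open>As \<open>s\<close> is the least bound of the sequence, \<open>f s\<close>
    already lies below some \<open>d (Suc k)\<close>; taking that as \<open>\<eta>\<close> and
    \<open>s\<close> as \<open>\<delta>\<close> violates the choice of \<open>g\<close>.\<close>
  have "f s \<notin> ?U" using s(2) fs lt_not_le by blast
  then obtain k where "f s \<preceq> d k" using fF dF not_lt by blast
  then have "f s \<prec> d (Suc k)" using le_lt_trans h(1) dF dS by metis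
  moreover have "g (d (Suc k)) \<prec> s"
    using h(2)[OF dF[of "Suc k"]] s(1) dS tr by (metis (mono_tags, lifting) mem_Collect_eq)
  ultimately show False using g(2) dF \<open>\<delta>0 \<prec> s\<close> by blast
qed

end

text \<open>Since the value of \<open>C\<close> at \<open>0\<close> is arbitrary, \<open>C b\<close> is known to lie below \<open>b\<close> only for \<open>b \<noteq> 0\<close>.\<close>

locale square_walk = uncountable_cofinality +
  fixes C :: "'a \<Rightarrow> 'a set"
  assumes C_below: "a \<prec> b \<Longrightarrow> c \<in> C b \<Longrightarrow> c \<prec> b"
    and C_step: "a \<prec> b \<Longrightarrow> \<exists>c\<in>C b. c = a \<or> a \<prec> c"
    and C_coherent: "limpt (C b) a \<Longrightarrow> a \<prec> b \<Longrightarrow> C a = C b \<inter> {x. x \<prec> a}"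
    and C_closed: "limpt (C b) a \<Longrightarrow> a \<prec> b \<Longrightarrow> a \<in> C b"
    and C_nontrivial: "D \<subseteq> F \<Longrightarrow> \<forall>x\<in>F. \<exists>d\<in>D. x \<prec> d \<Longrightarrow> \<forall>a\<in>F. limpt D a \<longrightarrow> a \<in> D \<Longrightarrow>
      \<forall>a\<in>F. \<exists>b\<in>F. (a = b \<or> a \<prec> b) \<and> D \<inter> {x. x \<prec> a} = C b \<inter> {x. x \<prec> a} \<Longrightarrow> False"
begin

section \<open>Walks and the coherence of their lengths\<close>

definition is_next :: "'a \<Rightarrow> 'a \<Rightarrow> 'a \<Rightarrow> bool" where
  "is_next a b c \<longleftrightarrow> c \<in> C b \<and> a \<preceq> c \<and> (\<forall>d\<in>C b. a \<preceq> d \<longrightarrow> c \<preceq> d)"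

definition nxt :: "'a \<Rightarrow> 'a \<Rightarrow> 'a" where
  "nxt a b = (THE c. is_next a b c)"

lemma nxt_eqI: "is_next a b c \<Longrightarrow> nxt a b = c"
  unfolding nxt_def is_next_def using le_antisym by blast

lemma is_next_nxt:
  assumes "a \<prec> b"
  shows "is_next a b (nxt a b)"
proof -
  let ?S = "{c \<in> C b. a \<preceq> c}"
  obtain c where "c \<in> ?S" using C_step[OF assms] unfolding le_def by blast
  moreover have "?S \<subseteq> F" using C_below[OF assms] lt_F by blast
  ultimately obtain z where "z \<in> ?S" "\<forall>y\<in>?S. z \<preceq> y" using ex_least by blast
  then have "is_next a b z" unfolding is_next_def by blast
  then show ?thesis using nxt_eqI by simp
qed

lemma nxt_lt: "a \<prec> b \<Longrightarrow> nxt a b \<prec> b"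
  using is_next_nxt C_below unfolding is_next_def by blast

lemma le_nxt: "a \<prec> b \<Longrightarrow> a \<preceq> nxt a b"
  using is_next_nxt unfolding is_next_def by blast

text \<open>Todorcevic's function \<open>rho_2\<close>. The value 0 is genuine for equal arguments
  and a mere default when \<open>b \<prec> a\<close>, so the lemmas below compare values only at
  points below both second arguments.\<close>

function rho :: "'a \<Rightarrow> 'a \<Rightarrow> nat" where
  "rho a b = (if a \<prec> b then Suc (rho a (nxt a b)) else 0)"
  by auto
termination
  by (relation "inv_image {(x, y). x \<prec> y} snd") (use wf_lt nxt_lt in auto)

declare rho.simps [simp del]

lemma rho_step: "a \<prec> b \<Longrightarrow> rho a b = Suc (rho a (nxt a b))"
  by (simp add: rho.simps)

text \<open>\<open>C b\<close> has no element from \<open>\<xi>\<close> up to \<open>a\<close>, so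
  both minima are taken over the same set.\<close>

lemma nxt_gap:
  assumes "a \<prec> b" "\<xi> \<prec> a" and gap: "\<And>d. d \<in> C b \<Longrightarrow> d \<prec> a \<Longrightarrow> d \<prec> \<xi>"
  shows "nxt \<xi> b = nxt a b"
proof (rule nxt_eqI)
  have n: "is_next a b (nxt a b)" by (rule is_next_nxt) fact
  have "a \<preceq> d" if "d \<in> C b" "\<xi> \<preceq> d" for d
    using that gap not_lt lt_F C_below assms(1) lt_not_le by meson
  then show "is_next \<xi> b (nxt a b)"
    using n assms(2) lt_le_trans unfolding is_next_def le_def by blast
qed

text \<open>The step from \<open>a\<close> towards \<open>\<xi>\<close> lands below
  \<open>a\<close>, where \<open>C a\<close> and \<open>C b\<close> agree by coherence. Hence both
  walks take the same first step and coincide from there on.\<close>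

lemma rho_limpt:
  assumes lp: "limpt (C b) a" and "a \<prec> b" "\<xi> \<prec> a"
  shows "rho \<xi> a = rho \<xi> b"
proof -
  note C = C_coherent[OF lp \<open>a \<prec> b\<close>]
  have n: "is_next \<xi> a (nxt \<xi> a)" by (rule is_next_nxt) fact
  have "is_next \<xi> b (nxt \<xi> a)"
    unfolding is_next_def
  proof (intro conjI ballI impI)
    show "nxt \<xi> a \<in> C b" "\<xi> \<preceq> nxt \<xi> a" using n C unfolding is_next_def by auto
    fix d assume d: "d \<in> C b" "\<xi> \<preceq> d"
    show "nxt \<xi> a \<preceq> d"
    proof (cases "d \<prec> a")
      case True
      then show ?thesis using n C d unfolding is_next_def by blast
    next
      case False
      then have "a \<preceq> d" using not_lt C_below[OF \<open>a \<prec> b\<close> d(1)] \<open>a \<prec> b\<close> lt_F by blast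
      then show ?thesis using nxt_lt[OF \<open>\<xi> \<prec> a\<close>] lt_le_trans unfolding le_def by blast
    qed
  qed
  then have "nxt \<xi> b = nxt \<xi> a" by (rule nxt_eqI)
  then show ?thesis using rho_step assms tr by metis
qed

definition close :: "'a \<Rightarrow> 'a \<Rightarrow> bool" where
  "close a b \<longleftrightarrow> (\<exists>m. \<forall>\<xi>. \<xi> \<prec> a \<longrightarrow> rho \<xi> a \<le> rho \<xi> b + m \<and> rho \<xi> b \<le> rho \<xi> a + m)"

text \<open>Induction on \<open>a\<close>, and for fixed \<open>a\<close> on \<open>b\<close>. If
  \<open>a\<close> is not a limit point of \<open>C b\<close> and not 0, then \<open>C b\<close>
  misses an interval between some \<open>\<eta>\<close> and \<open>a\<close>. Below
  \<open>\<eta>\<close>, both sides are compared with \<open>\<eta>\<close> by the outer induction;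
  above it, the walk from \<open>b\<close> first steps to \<open>nxt a b\<close>, which the inner
  induction handles.\<close>

lemma rho_close:
  assumes "a \<preceq> b" "a \<in> F"
  shows "close a b"
  using assms(2,1)
proof (induction a arbitrary: b rule: lt_induct)
  case (less a)
  note outer = less.IH
  have "b \<in> F" using less.hyps less.prems lt_F unfolding le_def by blast
  then show ?case using less.prems
  proof (induction b rule: lt_induct)
    case (less b)
    \<comment> \<open>The third case is \<open>a = 0\<close>, where there is nothing to
      compare.\<close>
    consider "a = b" | "a \<prec> b" "limpt (C b) a" | "\<forall>x. \<not> x \<prec> a"
      | \<eta> where "a \<prec> b" "\<eta> \<prec> a" "\<forall>d\<in>C b. \<not> (\<eta> \<prec> d \<and> d \<prec> a)"
      using less.prems unfolding le_def limpt_def by blast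
    then show ?case
    proof cases
      case 1
      then show ?thesis unfolding close_def by auto
    next
      case 2
      then show ?thesis unfolding close_def using rho_limpt by auto
    next
      case 3
      then show ?thesis unfolding close_def by auto
    next
      case 4
      have "close a (nxt a b)" using less.IH nxt_lt le_nxt 4(1) by blast
      then obtain m1 where m1: "\<And>\<xi>. \<xi> \<prec> a \<Longrightarrow>
          rho \<xi> a \<le> rho \<xi> (nxt a b) + m1 \<and> rho \<xi> (nxt a b) \<le> rho \<xi> a + m1"
        unfolding close_def by blast
      have "close \<eta> a" "close \<eta> b" using outer 4 tr unfolding le_def by blast+
      then obtain m2 m3 where
        m2: "\<And>\<xi>. \<xi> \<prec> \<eta> \<Longrightarrow> rho \<xi> \<eta> \<le> rho \<xi> a + m2 \<and> rho \<xi> a \<le> rho \<xi> \<eta> + m2" and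
        m3: "\<And>\<xi>. \<xi> \<prec> \<eta> \<Longrightarrow> rho \<xi> \<eta> \<le> rho \<xi> b + m3 \<and> rho \<xi> b \<le> rho \<xi> \<eta> + m3"
        unfolding close_def by blast
      \<comment> \<open>\<open>m2 + m3\<close> serves the points below \<open>\<eta>\<close>, the
        two values of \<open>rho\<close> serve \<open>\<eta>\<close> itself, and
        \<open>Suc m1\<close> serves the points above it, the successor counting the step from
        \<open>b\<close> to \<open>nxt a b\<close>.\<close>
      define M where "M = Suc m1 + m2 + m3 + rho \<eta> a + rho \<eta> b"
      have "rho \<xi> a \<le> rho \<xi> b + M \<and> rho \<xi> b \<le> rho \<xi> a + M" if \<xi>: "\<xi> \<prec> a" for \<xi>
      proof -
        consider "\<xi> \<prec> \<eta>" | "\<xi> = \<eta>" | "\<eta> \<prec> \<xi>" using tot \<xi> 4(2) lt_F by blast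
        then show ?thesis
        proof cases
          case 1
          show ?thesis using m2[OF 1] m3[OF 1] unfolding M_def by linarith
        next
          case 2
          then show ?thesis unfolding M_def by simp
        next
          case 3
          have "nxt \<xi> b = nxt a b"
          proof (rule nxt_gap[OF 4(1) \<xi>])
            fix d assume "d \<in> C b" "d \<prec> a"
            then show "d \<prec> \<xi>"
              using 4(2,3) 3 not_lt[of \<eta> d] lt_F le_lt_trans[of d \<eta> \<xi>] by blast
          qed
          then have "rho \<xi> b = Suc (rho \<xi> (nxt a b))"
            using rho_step tr[OF \<xi> 4(1)] by metis
          then show ?thesis using m1[OF \<xi>] unfolding M_def by linarith
        qed
      qed
      then show ?thesis unfolding close_def by blast
    qed
  qed
qed

text \<open>Whichever of \<open>a\<close> and \<open>b\<close> is smaller, \<open>rho_close\<close>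
  applies to the pair, and closeness bounds the difference in both directions.\<close>

lemma rho_bounded_transfer:
  assumes "a \<in> F" "b \<in> F" and "\<And>x. x \<in> X \<Longrightarrow> x \<prec> a \<and> x \<prec> b" and "\<And>x. x \<in> X \<Longrightarrow> rho x a \<le> m"
  shows "\<exists>n. \<forall>x\<in>X. rho x b \<le> n"
proof -
  have "close a b \<or> close b a"
    using rho_close tot[OF assms(1,2)] assms(1,2) unfolding le_def by blast
  then obtain k where "\<And>x. x \<in> X \<Longrightarrow> rho x b \<le> rho x a + k"
    unfolding close_def using assms(3) by blast
  then have "\<forall>x\<in>X. rho x b \<le> m + k" using assms(4) by (meson add_le_mono1 order_trans)
  then show ?thesis by blast
qed

section \<open>Unbounded sets are not uniformly close to cofinally many points\<close>

text \<open>The bound is asked only below \<open>\<zeta>\<close>, not below all of \<open>b\<close>.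
  This lets it survive when \<open>b\<close> is replaced by a later point of its walk that is still
  above \<open>\<zeta>\<close>.\<close>

definition low :: "'a set \<Rightarrow> nat \<Rightarrow> bool" where
  "low A n \<longleftrightarrow> (\<forall>\<zeta>\<in>F. \<exists>b\<in>F. \<zeta> \<preceq> b \<and> (\<forall>a\<in>A. a \<prec> \<zeta> \<longrightarrow> rho a b \<le> n))"

text \<open>Induction on \<open>n\<close>; a walk between distinct points has at least one step,
  which settles 0. For the successor, either \<open>E\<close> is unbounded and the sets
  \<open>C \<delta>\<close> for \<open>\<delta>\<close> in \<open>E\<close> cohere to a forbidden
  club, or pressing down gives an unbounded \<open>A'\<close> that is \<open>low\<close> with
  \<open>n\<close>.\<close>

lemma not_low:
  assumes "A \<subseteq> F" "\<forall>x\<in>F. \<exists>a\<in>A. x \<prec> a"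
  shows "\<not> low A n"
  using assms
proof (induction n arbitrary: A)
  case 0
  obtain x where "x \<in> F" using countable_bounded[of "{}"] by auto
  then obtain a where a: "a \<in> A" using 0 by blast
  then obtain \<zeta> where \<zeta>: "\<zeta> \<in> F" "a \<prec> \<zeta>" using 0 ex_common_bound by blast
  show ?case
  proof
    assume "low A 0"
    then obtain b where "\<zeta> \<preceq> b" "rho a b \<le> 0" using a \<zeta> unfolding low_def by blast
    moreover have "a \<prec> b" using \<zeta>(2) \<open>\<zeta> \<preceq> b\<close> by (rule lt_le_trans)
    ultimately show False using rho_step by simp
  qed
next
  case (Suc n)
  show ?case
  proof
    assume low: "low A (Suc n)"
    \<comment> \<open>Strictness of \<open>\<delta> \<prec> b\<close> allows coherence to be applied
      at \<open>\<delta>\<close>.\<close>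
    define good where "good \<delta> b \<longleftrightarrow> \<delta> \<prec> b \<and> (\<forall>a\<in>A. a \<prec> \<delta> \<longrightarrow> rho a b \<le> Suc n)" for \<delta> b
    have ex_good: "\<exists>b. good \<delta> b" if "\<delta> \<in> F" for \<delta>
    proof -
      obtain \<zeta> where \<zeta>: "\<zeta> \<in> F" "\<delta> \<prec> \<zeta>" using ex_common_bound \<open>\<delta> \<in> F\<close> by blast
      then obtain b where "\<zeta> \<preceq> b" "\<forall>a\<in>A. a \<prec> \<zeta> \<longrightarrow> rho a b \<le> Suc n"
        using low unfolding low_def by blast
      then show ?thesis unfolding good_def using \<zeta>(2) lt_le_trans tr by blast
    qed
    \<comment> \<open>Quantifying over every good \<open>b\<close> matters: by \<open>rhoE\<close>,
      a larger \<open>\<delta>'\<close> in \<open>E\<close> is itself good for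
      \<open>\<delta>\<close>, so \<open>\<delta>\<close> is a limit point of
      \<open>C \<delta>'\<close>.\<close>
    define E where "E = {\<delta> \<in> F. \<forall>b. good \<delta> b \<longrightarrow> limpt (C b) \<delta>}"
    show False
    proof (cases "\<forall>x\<in>F. \<exists>\<delta>\<in>E. x \<prec> \<delta>")
      case True
      have rhoE: "rho a \<delta> \<le> Suc n" if "\<delta> \<in> E" "a \<in> A" "a \<prec> \<delta>" for a \<delta>
      proof -
        obtain b where b: "good \<delta> b" using ex_good \<open>\<delta> \<in> E\<close> unfolding E_def by blast
        then have "limpt (C b) \<delta>" using that(1) unfolding E_def by blast
        then have "rho a \<delta> = rho a b" using b that(3) rho_limpt unfolding good_def by blast
        then show ?thesis using b that unfolding good_def by simp
      qed
      have limE: "limpt (C \<delta>') \<delta>" if "\<delta> \<in> E" "\<delta>' \<in> E" "\<delta> \<prec> \<delta>'" for \<delta> \<delta>'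
      proof -
        have "good \<delta> \<delta>'" unfolding good_def using that rhoE tr by blast
        then show ?thesis using that(1) unfolding E_def by blast
      qed
      have cohE: "C \<delta> = C \<delta>' \<inter> {x. x \<prec> \<delta>}" if "\<delta> \<in> E" "\<delta>' \<in> E" "\<delta> \<prec> \<delta>'" for \<delta> \<delta>'
        using C_coherent limE that by blast
      \<comment> \<open>Coherence with a larger element of \<open>E\<close> gives this directly,
        whereas \<open>C_below\<close> would first need a point below
        \<open>\<delta>\<close>.\<close>
      have ltE: "x \<prec> \<delta>" if "\<delta> \<in> E" "x \<in> C \<delta>" for x \<delta>
      proof -
        obtain \<delta>' where "\<delta>' \<in> E" "\<delta> \<prec> \<delta>'" using True \<open>\<delta> \<in> E\<close> unfolding E_def by blast
        then show ?thesis using cohE that by blast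
      qed
      \<comment> \<open>By \<open>cohE\<close> these sets are initial segments of one another, so
        any \<open>\<delta>\<close> in \<open>E\<close> above \<open>a\<close> witnesses that
        \<open>D\<close> is threaded at \<open>a\<close>.\<close>
      define D where "D = (\<Union>\<delta>\<in>E. C \<delta>)"
      have D: "D \<inter> {x. x \<prec> \<delta>} = C \<delta>" if "\<delta> \<in> E" for \<delta>
      proof
        show "C \<delta> \<subseteq> D \<inter> {x. x \<prec> \<delta>}" using that ltE unfolding D_def by blast
        show "D \<inter> {x. x \<prec> \<delta>} \<subseteq> C \<delta>"
        proof
          fix x assume "x \<in> D \<inter> {x. x \<prec> \<delta>}"
          then obtain \<epsilon> where \<epsilon>: "\<epsilon> \<in> E" "x \<in> C \<epsilon>" "x \<prec> \<delta>" unfolding D_def by blast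
          have "\<epsilon> \<prec> \<delta> \<or> \<epsilon> = \<delta> \<or> \<delta> \<prec> \<epsilon>" using tot \<epsilon>(1) that unfolding E_def by blast
          then show "x \<in> C \<delta>" using cohE[OF \<epsilon>(1) that] cohE[OF that \<epsilon>(1)] \<epsilon> by blast
        qed
      qed
      show False
      proof (rule C_nontrivial)
        show "D \<subseteq> F" using ltE lt_F unfolding D_def by blast
        show "\<forall>x\<in>F. \<exists>d\<in>D. x \<prec> d"
        proof
          fix x assume "x \<in> F"
          then obtain \<delta> where \<delta>: "\<delta> \<in> E" "x \<prec> \<delta>" using True by blast
          then obtain \<delta>' where \<delta>': "\<delta>' \<in> E" "\<delta> \<prec> \<delta>'" using True lt_F by blast
          have "limpt (C \<delta>') \<delta>" by (rule limE) fact+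
          then show "\<exists>d\<in>D. x \<prec> d" using \<delta>(2) \<delta>'(1) unfolding limpt_def D_def by blast
        qed
        show "\<forall>a\<in>F. limpt D a \<longrightarrow> a \<in> D"
        proof (intro ballI impI)
          fix a assume "a \<in> F" and lp: "limpt D a"
          then obtain \<delta> where \<delta>: "\<delta> \<in> E" "a \<prec> \<delta>" using True by blast
          have "limpt (C \<delta>) a"
            using lp \<delta>(2) D[OF \<delta>(1)] tr unfolding limpt_def by blast
          then show "a \<in> D" using C_closed \<delta> unfolding D_def by blast
        qed
        show "\<forall>a\<in>F. \<exists>b\<in>F. (a = b \<or> a \<prec> b) \<and> D \<inter> {x. x \<prec> a} = C b \<inter> {x. x \<prec> a}"
        proof
          fix a assume "a \<in> F"
          then obtain \<delta> where \<delta>: "\<delta> \<in> E" "a \<prec> \<delta>" using True by blast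
          have "D \<inter> {x. x \<prec> a} = C \<delta> \<inter> {x. x \<prec> a}"
            using D[OF \<delta>(1)] \<delta>(2) tr by blast
          then show "\<exists>b\<in>F. (a = b \<or> a \<prec> b) \<and> D \<inter> {x. x \<prec> a} = C b \<inter> {x. x \<prec> a}"
            using \<delta> lt_F by blast
        qed
      qed
    next
      case False
      then obtain \<delta>0 where \<delta>0: "\<delta>0 \<in> F" "\<And>\<delta>. \<delta>0 \<prec> \<delta> \<Longrightarrow> \<delta> \<notin> E" by blast
      have "\<exists>b x. good \<delta> b \<and> x \<prec> \<delta> \<and> (\<forall>d\<in>C b. \<not> (x \<prec> d \<and> d \<prec> \<delta>))"
        if "\<delta>0 \<prec> \<delta>" for \<delta>
      proof -
        have "\<delta> \<notin> E" "\<delta> \<in> F" using \<delta>0(2) that lt_F by blast+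
        then obtain b where "good \<delta> b" "\<not> limpt (C b) \<delta>" unfolding E_def by blast
        then show ?thesis using that unfolding limpt_def by blast
      qed
      \<comment> \<open>For \<open>\<delta>\<close> outside \<open>E\<close>, some good
        \<open>\<beta> \<delta>\<close> has a gap in its \<open>C\<close> just below
        \<open>\<delta>\<close>, and \<open>f \<delta>\<close> is where that gap starts.\<close>
      then obtain \<beta> f where \<beta>: "\<And>\<delta>. \<delta>0 \<prec> \<delta> \<Longrightarrow> good \<delta> (\<beta> \<delta>)"
        and f: "\<And>\<delta>. \<delta>0 \<prec> \<delta> \<Longrightarrow> f \<delta> \<prec> \<delta>"
        and gap: "\<And>\<delta> d. \<delta>0 \<prec> \<delta> \<Longrightarrow> d \<in> C (\<beta> \<delta>) \<Longrightarrow> d \<prec> \<delta> \<Longrightarrow> \<not> f \<delta> \<prec> d"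
        by metis
      obtain \<eta> where \<eta>: "\<eta> \<in> F" "\<And>\<zeta>. \<zeta> \<in> F \<Longrightarrow> \<exists>\<delta>. \<zeta> \<prec> \<delta> \<and> \<delta>0 \<prec> \<delta> \<and> f \<delta> \<prec> \<eta>"
        using pressing_down[OF \<delta>0(1) f] by blast
      \<comment> \<open>For cofinally many \<open>\<delta>\<close> the gap starts below
        \<open>\<eta>\<close>, so every element of \<open>A'\<close> below \<open>\<delta>\<close>
        lies inside it. The walks from \<open>\<beta> \<delta>\<close> to these elements share the
        first step \<open>nxt \<delta> (\<beta> \<delta>)\<close>; dropping it lowers the bound to
        \<open>n\<close>.\<close>
      define A' where "A' = {a \<in> A. \<eta> \<prec> a}"
      have "low A' n"
        unfolding low_def
      proof
        fix \<zeta> assume "\<zeta> \<in> F"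
        then obtain \<delta> where \<delta>: "\<zeta> \<prec> \<delta>" "\<delta>0 \<prec> \<delta>" "f \<delta> \<prec> \<eta>" using \<eta>(2) by blast
        have \<beta>\<delta>: "\<delta> \<prec> \<beta> \<delta>" using \<beta> \<delta>(2) unfolding good_def by blast
        let ?c = "nxt \<delta> (\<beta> \<delta>)"
        have "rho a ?c \<le> n" if a: "a \<in> A'" "a \<prec> \<zeta>" for a
        proof -
          have a\<delta>: "a \<prec> \<delta>" using a \<delta>(1) tr by blast
          have "f \<delta> \<prec> a" using a(1) \<delta>(3) tr unfolding A'_def by blast
          have "nxt a (\<beta> \<delta>) = ?c"
          proof (rule nxt_gap[OF \<beta>\<delta> a\<delta>])
            fix d assume d: "d \<in> C (\<beta> \<delta>)" "d \<prec> \<delta>"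
            then have "d \<preceq> f \<delta>" using gap[OF \<delta>(2)] not_lt \<delta>(3) lt_F by blast
            then show "d \<prec> a" using \<open>f \<delta> \<prec> a\<close> by (rule le_lt_trans)
          qed
          then have "rho a (\<beta> \<delta>) = Suc (rho a ?c)"
            using rho_step tr[OF a\<delta> \<beta>\<delta>] by metis
          moreover have "rho a (\<beta> \<delta>) \<le> Suc n"
            using \<beta>[OF \<delta>(2)] a(1) a\<delta> unfolding good_def A'_def by blast
          ultimately show ?thesis by simp
        qed
        moreover have "\<zeta> \<prec> ?c" using \<delta>(1) le_nxt[OF \<beta>\<delta>] by (rule lt_le_trans)
        ultimately show "\<exists>b\<in>F. \<zeta> \<preceq> b \<and> (\<forall>a\<in>A'. a \<prec> \<zeta> \<longrightarrow> rho a b \<le> n)"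
          using lt_F unfolding le_def by blast
      qed
      moreover have "\<forall>x\<in>F. \<exists>a\<in>A'. x \<prec> a"
      proof
        fix x assume "x \<in> F"
        then obtain y where "y \<in> F" "x \<prec> y" "\<eta> \<prec> y" using ex_common_bound \<eta>(1) by blast
        moreover obtain a where "a \<in> A" "y \<prec> a" using Suc.prems(2) \<open>y \<in> F\<close> by blast
        ultimately show "\<exists>a\<in>A'. x \<prec> a" using tr unfolding A'_def by blast
      qed
      moreover have "A' \<subseteq> F" using Suc.prems(1) unfolding A'_def by blast
      ultimately show False using Suc.IH by blast
    qed
  qed
qed

text \<open>If all countably infinite subsets were covered, \<open>rho\<close> into each fixed point
  would be bounded on \<open>A\<close> below that point. By \<open>not_low\<close> each bound
  \<open>n\<close> fails from some \<open>z n\<close> on, so a point \<open>y\<close> above all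
  \<open>z n\<close> admits no bound.\<close>

lemma uncovered_countable_subset:
  assumes A: "A \<subseteq> F" "\<forall>x\<in>F. \<exists>a\<in>A. x \<prec> a"
  shows "\<exists>X \<subseteq> A. countable X \<and> infinite X \<and>
    (\<forall>n. \<forall>b\<in>F. \<not> X \<subseteq> {x. x \<prec> b \<and> rho x b \<le> n})"
proof (rule ccontr)
  assume "\<not> ?thesis"
  then have cov: "\<exists>n. \<exists>b\<in>F. X \<subseteq> {x. x \<prec> b \<and> rho x b \<le> n}"
    if "X \<subseteq> A" "countable X" "infinite X" for X
    using that by blast
  have single: "\<exists>n. \<forall>x\<in>A. x \<prec> a \<longrightarrow> rho x a \<le> n" if "a \<in> F" for a
  proof (rule ccontr)
    assume "\<not> ?thesis"
    then have "\<forall>n. \<exists>x. x \<in> A \<and> x \<prec> a \<and> n < rho x a" by (meson not_le)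
    then obtain x where x: "\<And>n. x n \<in> A" "\<And>n. x n \<prec> a" "\<And>n. n < rho (x n) a"
      by metis
    \<comment> \<open>A set covering \<open>range x\<close> would bound \<open>rho\<close> into
      \<open>b\<close>, and \<open>rho_bounded_transfer\<close> would carry that bound back to
      \<open>a\<close>.\<close>
    have unb: "\<not> (\<exists>m. \<forall>y\<in>range x. rho y a \<le> m)"
      using x(3) by (meson not_le rangeI)
    have "infinite (range x)"
    proof
      assume "finite (range x)"
      then have "\<forall>y\<in>range x. rho y a \<le> Max ((\<lambda>y. rho y a) ` range x)" by simp
      then show False using unb by blast
    qed
    then obtain n b where b: "b \<in> F" "range x \<subseteq> {x. x \<prec> b \<and> rho x b \<le> n}"
      using cov[of "range x"] x(1) by auto
    have "\<exists>m. \<forall>y\<in>range x. rho y a \<le> m"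
      by (rule rho_bounded_transfer[OF b(1) that, where m = n]) (use b(2) x(2) in auto)
    then show False using unb by blast
  qed
  have "\<forall>n. \<exists>\<zeta>. \<zeta> \<in> F \<and> (\<forall>b\<in>F. \<zeta> \<preceq> b \<longrightarrow> (\<exists>a\<in>A. a \<prec> \<zeta> \<and> \<not> rho a b \<le> n))"
    using not_low[OF A] unfolding low_def by blast
  then obtain z where z: "\<And>n. z n \<in> F"
    "\<And>n b. b \<in> F \<Longrightarrow> z n \<preceq> b \<Longrightarrow> \<exists>a\<in>A. a \<prec> z n \<and> \<not> rho a b \<le> n"
    by metis
  have "\<exists>y\<in>F. \<forall>x\<in>range z. x \<prec> y"
    by (rule countable_bounded) (use z(1) in auto)
  then obtain y where y: "y \<in> F" "\<And>n. z n \<prec> y" by blast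
  obtain n where "\<forall>x\<in>A. x \<prec> y \<longrightarrow> rho x y \<le> n" using single y(1) by blast
  then show False using z(2)[OF y(1), of n] y(2)[of n] tr unfolding le_def by blast
qed

end

section \<open>Regular cardinals and square sequences as instances of the locales\<close>

lemma infinite_Field:
  assumes "Card_order \<kappa>" "natLeq <o \<kappa>"
  shows "infinite (Field \<kappa>)"
  using assms infinite_iff_natLeq_ordLeq
  by (metis card_of_Field_ordIso ordIso_symmetric ordLeq_ordIso_trans ordLess_imp_ordLeq)

text \<open>A countable set is smaller than \<open>\<kappa>\<close>, hence not cofinal. This yields
  only a weak upper bound \<open>a\<close>; an infinite cardinal has no greatest element, so some
  \<open>y\<close> lies strictly above \<open>a\<close>.\<close>

lemma regular_countable_bounded:
  assumes \<kappa>: "Card_order \<kappa>" "regularCard \<kappa>" "natLeq <o \<kappa>"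
    and X: "X \<subseteq> Field \<kappa>" "countable X"
  shows "\<exists>y\<in>Field \<kappa>. \<forall>x\<in>X. x \<in> underS \<kappa> y"
proof -
  interpret R: wo_rel \<kappa> using \<kappa>(1) unfolding wo_rel_def card_order_on_def by blast
  have inf: "infinite (Field \<kappa>)" using \<kappa>(1,3) by (rule infinite_Field)
  have "|X| <o \<kappa>"
    using X(2) \<kappa>(3) ordLeq_ordLess_trans countable_card_le_natLeq by blast
  then have "\<not> cofinal X \<kappa>"
    using \<kappa>(2) X(1) not_ordLess_ordIso unfolding regularCard_def by blast
  then obtain a where a: "a \<in> Field \<kappa>" "\<And>b. b \<in> X \<Longrightarrow> a = b \<or> (a, b) \<notin> \<kappa>"
    unfolding cofinal_def by blast
  obtain y where y: "y \<in> Field \<kappa>" "a \<noteq> y" "(a, y) \<in> \<kappa>"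
    using infinite_Card_order_limit[OF \<kappa>(1) inf a(1)] by blast
  have "x \<in> underS \<kappa> y" if "x \<in> X" for x
  proof -
    have "(x, a) \<in> \<kappa>" using a that X(1) R.TOTALS by blast
    then show ?thesis using y R.TRANS R.ANTISYM unfolding underS_def trans_def antisym_def by blast
  qed
  then show ?thesis using y(1) by blast
qed

lemma uncountable_cofinality_regularCard:
  assumes \<kappa>: "Card_order \<kappa>" "regularCard \<kappa>" "natLeq <o \<kappa>"
  shows "uncountable_cofinality (Field \<kappa>) (\<lambda>x y. x \<in> underS \<kappa> y)"
proof -
  interpret R: wo_rel \<kappa> using \<kappa>(1) unfolding wo_rel_def card_order_on_def by blast
  show ?thesis
  proof
    show "x \<in> Field \<kappa> \<and> y \<in> Field \<kappa>" if "x \<in> underS \<kappa> y" for x y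
      using that unfolding underS_def Field_def by blast
    show "x \<notin> underS \<kappa> x" for x unfolding underS_def by blast
    show "x \<in> underS \<kappa> z" if "x \<in> underS \<kappa> y" "y \<in> underS \<kappa> z" for x y z
      using that R.TRANS R.ANTISYM unfolding underS_def trans_def antisym_def by blast
    show "x \<in> underS \<kappa> y \<or> x = y \<or> y \<in> underS \<kappa> x"
      if "x \<in> Field \<kappa>" "y \<in> Field \<kappa>" for x y
      using that R.TOTALS unfolding underS_def by blast
    have "{(x, y). x \<in> underS \<kappa> y} = \<kappa> - Id" unfolding underS_def by auto
    then show "wf {(x, y). x \<in> underS \<kappa> y}" using R.WF by simp
    show "\<exists>y\<in>Field \<kappa>. \<forall>x\<in>X. x \<in> underS \<kappa> y" if "X \<subseteq> Field \<kappa>" "countable X" for X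
      using regular_countable_bounded[OF \<kappa> that] .
  qed
qed

text \<open>\<open>suc\<close> selects the least strict upper bound, which is meaningful only if one
  exists; infinity of the field ensures this.\<close>

lemma suc_singleton:
  assumes \<kappa>: "Card_order \<kappa>" "infinite (Field \<kappa>)" and \<beta>: "\<beta> \<in> Field \<kappa>"
  shows "\<beta> \<in> underS \<kappa> (wo_rel.suc \<kappa> {\<beta>})"
    and "a \<in> underS \<kappa> (wo_rel.suc \<kappa> {\<beta>}) \<Longrightarrow> (a, \<beta>) \<in> \<kappa>"
proof -
  interpret R: wo_rel \<kappa> using \<kappa>(1) unfolding wo_rel_def card_order_on_def by blast
  obtain y where "y \<in> Field \<kappa>" "\<beta> \<noteq> y" "(\<beta>, y) \<in> \<kappa>"
    using infinite_Card_order_limit[OF \<kappa> \<beta>] by blast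
  then have ne: "R.AboveS {\<beta>} \<noteq> {}" unfolding AboveS_def by auto
  show "\<beta> \<in> underS \<kappa> (R.suc {\<beta>})"
    using R.suc_greater[of "{\<beta>}" \<beta>] ne \<beta> unfolding underS_def by auto
  show "(a, \<beta>) \<in> \<kappa>" if a: "a \<in> underS \<kappa> (R.suc {\<beta>})"
  proof (rule ccontr)
    assume "(a, \<beta>) \<notin> \<kappa>"
    moreover have aF: "a \<in> Field \<kappa>" using a unfolding underS_def Field_def by blast
    ultimately have "(\<beta>, a) \<in> \<kappa>" "a \<noteq> \<beta>" using \<beta> R.TOTALS by blast+
    then have "a \<in> R.AboveS {\<beta>}" using aF unfolding AboveS_def by auto
    then have "(R.suc {\<beta>}, a) \<in> \<kappa>" by (rule R.suc_least_AboveS)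
    then show False using a R.ANTISYM unfolding underS_def antisym_def by blast
  qed
qed

lemma square_walk_square_sequence:
  assumes \<kappa>: "Card_order \<kappa>" "regularCard \<kappa>" "natLeq <o \<kappa>"
    and sq: "square_sequence \<kappa> C"
  shows "square_walk (Field \<kappa>) (\<lambda>x y. x \<in> underS \<kappa> y) C"
proof -
  interpret R: wo_rel \<kappa> using \<kappa>(1) unfolding wo_rel_def card_order_on_def by blast
  interpret U: uncountable_cofinality "Field \<kappa>" "\<lambda>x y. x \<in> underS \<kappa> y"
    by (rule uncountable_cofinality_regularCard) fact+
  have inf: "infinite (Field \<kappa>)" using \<kappa>(1,3) by (rule infinite_Field)
  have leq: "(a, b) \<in> \<kappa> \<longleftrightarrow> a = b \<or> a \<in> underS \<kappa> b" if "a \<in> Field \<kappa>" for a b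
    using that R.REFL unfolding underS_def refl_on_def by blast
  have lp: "U.limpt S a \<longleftrightarrow> limit_point \<kappa> S a" for S a
    unfolding U.limpt_def limit_point_def unbounded_in_def using U.lt_F by blast
  have lim: "club_in \<kappa> (underS \<kappa> b) (C b)" if "limit_ordinal \<kappa> b" for b
    using sq that unfolding square_sequence_def by blast
  have sucC: "C (R.suc {\<beta>}) = {\<beta>}" if "\<beta> \<in> Field \<kappa>" for \<beta>
    using sq that unfolding square_sequence_def by blast
  note suc1 = suc_singleton(1)[OF \<kappa>(1) inf] and suc2 = suc_singleton(2)[OF \<kappa>(1) inf]
  \<comment> \<open>The point \<open>a\<close> below \<open>b\<close> rules out
    \<open>b = 0\<close>.\<close>
  have cases: "limit_ordinal \<kappa> b \<or> (\<exists>\<beta>\<in>Field \<kappa>. b = R.suc {\<beta>})" if "a \<in> underS \<kappa> b" for a b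
    using that U.lt_F unfolding limit_ordinal_def by blast
  show ?thesis
  proof
    show "c \<in> underS \<kappa> b" if "a \<in> underS \<kappa> b" "c \<in> C b" for a b c
      using cases[OF that(1)]
    proof
      assume "limit_ordinal \<kappa> b"
      then show ?thesis using lim that unfolding club_in_def by blast
    next
      assume "\<exists>\<beta>\<in>Field \<kappa>. b = R.suc {\<beta>}"
      then obtain \<beta> where \<beta>: "\<beta> \<in> Field \<kappa>" "b = R.suc {\<beta>}" by blast
      then have "c = \<beta>" using sucC that(2) by simp
      then show ?thesis using suc1 \<beta> by simp
    qed
    show "\<exists>c\<in>C b. c = a \<or> a \<in> underS \<kappa> c" if "a \<in> underS \<kappa> b" for a b
      using cases[OF that]
    proof
      assume "limit_ordinal \<kappa> b"
      then show ?thesis using lim that unfolding club_in_def unbounded_in_def by blast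
    next
      assume "\<exists>\<beta>\<in>Field \<kappa>. b = R.suc {\<beta>}"
      then obtain \<beta> where \<beta>: "\<beta> \<in> Field \<kappa>" "b = R.suc {\<beta>}" by blast
      then have "(a, \<beta>) \<in> \<kappa>" using suc2 that by blast
      then have "\<beta> = a \<or> a \<in> underS \<kappa> \<beta>" unfolding underS_def by blast
      then show ?thesis using sucC \<beta> by auto
    qed
    show "C a = C b \<inter> {x. x \<in> underS \<kappa> a}" if "U.limpt (C b) a" "a \<in> underS \<kappa> b" for a b
      using sq that U.lt_F unfolding square_sequence_def lp by auto
    show "a \<in> C b" if l: "U.limpt (C b) a" and ab: "a \<in> underS \<kappa> b" for a b
      using cases[OF ab]
    proof
      assume "limit_ordinal \<kappa> b"
      then show ?thesis using lim ab l unfolding club_in_def lp by blast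
    next
      assume "\<exists>\<beta>\<in>Field \<kappa>. b = R.suc {\<beta>}"
      then obtain \<beta> where \<beta>: "C b = {\<beta>}" using sucC by blast
      \<comment> \<open>A singleton has no limit point: applied to \<open>\<beta>\<close> itself,
        the condition would put \<open>\<beta>\<close> strictly below
        \<open>\<beta>\<close>.\<close>
      then have "\<exists>x. x \<in> underS \<kappa> a" "\<And>x. x \<in> underS \<kappa> a \<Longrightarrow> x \<in> underS \<kappa> \<beta> \<and> \<beta> \<in> underS \<kappa> a"
        using l unfolding U.limpt_def by auto
      then have "\<beta> \<in> underS \<kappa> \<beta>" by blast
      then show ?thesis using U.irr by blast
    qed
    show False
      if D: "D \<subseteq> Field \<kappa>" "\<forall>x\<in>Field \<kappa>. \<exists>d\<in>D. x \<in> underS \<kappa> d"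
        "\<forall>a\<in>Field \<kappa>. U.limpt D a \<longrightarrow> a \<in> D"
        "\<forall>a\<in>Field \<kappa>. \<exists>b\<in>Field \<kappa>. (a = b \<or> a \<in> underS \<kappa> b) \<and>
          D \<inter> {x. x \<in> underS \<kappa> a} = C b \<inter> {x. x \<in> underS \<kappa> a}" for D
    proof -
      have "club_in \<kappa> (Field \<kappa>) D"
        using D(1-3) unfolding club_in_def unbounded_in_def lp by blast
      moreover have "\<forall>a\<in>Field \<kappa>. \<exists>b\<in>Field \<kappa>. (a, b) \<in> \<kappa> \<and>
          D \<inter> underS \<kappa> a = C b \<inter> underS \<kappa> a"
        using D(4) leq by simp
      ultimately show False using sq unfolding square_sequence_def by blast
    qed
  qed
qed

section \<open>The covering matrix of walk lengths and the contradiction with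
  \<open>CP_omega\<close>\<close>

text \<open>The sets at \<open>b\<close> have size below \<open>\<kappa>\<close> because they are
  subsets of \<open>b\<close>. Comparing two columns, and bounding traces on a countable
  \<open>X\<close>, both reduce to \<open>rho_bounded_transfer\<close>.\<close>

lemma omega_covering_matrix_rho:
  assumes \<kappa>: "Card_order \<kappa>" and W: "square_walk (Field \<kappa>) (\<lambda>x y. x \<in> underS \<kappa> y) C"
  shows "omega_covering_matrix \<kappa>
    (\<lambda>n b. {a. a \<in> underS \<kappa> b \<and> square_walk.rho (\<lambda>x y. x \<in> underS \<kappa> y) C a b \<le> n})"
proof -
  interpret W: square_walk "Field \<kappa>" "\<lambda>x y. x \<in> underS \<kappa> y" C by fact
  let ?K = "\<lambda>n b. {a. a \<in> underS \<kappa> b \<and> W.rho a b \<le> n}"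
  have transfer: "\<exists>n. ?K m \<beta> \<inter> underS \<kappa> \<gamma> \<subseteq> ?K n \<gamma>"
    if "\<beta> \<in> Field \<kappa>" "\<gamma> \<in> Field \<kappa>" for \<beta> \<gamma> m
    using W.rho_bounded_transfer[OF that, of "?K m \<beta> \<inter> underS \<kappa> \<gamma>" m] by blast
  show ?thesis
    unfolding omega_covering_matrix_def
  proof (intro conjI allI ballI impI)
    show "?K n \<beta> \<subseteq> Field \<kappa>" for n \<beta> using W.lt_F by blast
    show "underS \<kappa> \<beta> \<subseteq> (\<Union>n. ?K n \<beta>)" for \<beta> by auto
    show "|?K n \<beta>| <o \<kappa>" if "\<beta> \<in> Field \<kappa>" for n \<beta>
      by (rule ordLeq_ordLess_trans[OF card_of_mono1 card_of_underS[OF \<kappa> that]]) auto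
    show "?K n \<beta> \<subseteq> ?K m \<beta>" if "n < m" for n m :: nat and \<beta> using that by auto
    show "\<exists>m. ?K n \<gamma> \<subseteq> ?K m \<beta>" if "\<beta> \<in> Field \<kappa>" "\<gamma> \<in> underS \<kappa> \<beta>" for n \<gamma> \<beta>
    proof -
      have "\<gamma> \<in> Field \<kappa>" using that W.lt_F by blast
      then obtain m where "?K n \<gamma> \<inter> underS \<kappa> \<beta> \<subseteq> ?K m \<beta>" using transfer \<open>\<beta> \<in> Field \<kappa>\<close> by meson
      moreover have "?K n \<gamma> \<subseteq> underS \<kappa> \<beta>" using W.tr that(2) by blast
      ultimately show ?thesis by blast
    qed
    show "\<exists>\<gamma>\<in>Field \<kappa>. \<forall>\<beta>\<in>Field \<kappa>. \<forall>m. \<exists>n. ?K m \<beta> \<inter> X \<subseteq> ?K n \<gamma>"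
      if X: "X \<subseteq> Field \<kappa> \<and> countable X" for X
    proof -
      \<comment> \<open>Any \<open>\<gamma>\<close> above all of \<open>X\<close> works, since the
        transfer to \<open>\<gamma>\<close> then loses no element of \<open>X\<close>.\<close>
      obtain \<gamma> where \<gamma>: "\<gamma> \<in> Field \<kappa>" "\<forall>x\<in>X. x \<in> underS \<kappa> \<gamma>"
        using W.countable_bounded X by blast
      have "\<exists>n. ?K m \<beta> \<inter> X \<subseteq> ?K n \<gamma>" if \<beta>: "\<beta> \<in> Field \<kappa>" for m \<beta>
      proof -
        obtain n where "?K m \<beta> \<inter> underS \<kappa> \<gamma> \<subseteq> ?K n \<gamma>" using transfer[OF \<beta> \<gamma>(1)] by meson
        then show ?thesis using \<gamma>(2) by blast
      qed
      then show ?thesis using \<gamma>(1) by blast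
    qed
  qed
qed

theorem mainTheorem5:
  fixes \<kappa> :: "'a rel"
  assumes "Card_order \<kappa>" and "regularCard \<kappa>" and "cardSuc natLeq <o \<kappa>"
    and "CP_omega \<kappa>"
  shows "\<not> square \<kappa>"
proof
  assume "square \<kappa>"
  then obtain C where C: "square_sequence \<kappa> C" unfolding square_def by blast
  have "natLeq <o \<kappa>"
    using cardSuc_greater[OF natLeq_Card_order] assms(3) ordLess_transitive by blast
  then have walk: "square_walk (Field \<kappa>) (\<lambda>x y. x \<in> underS \<kappa> y) C"
    using square_walk_square_sequence assms(1,2) C by blast
  then interpret W: square_walk "Field \<kappa>" "\<lambda>x y. x \<in> underS \<kappa> y" C .
  let ?K = "\<lambda>n b. {a. a \<in> underS \<kappa> b \<and> W.rho a b \<le> n}"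
  have "\<exists>A. A \<subseteq> Field \<kappa> \<and> unbounded_in \<kappa> (Field \<kappa>) A \<and>
      (\<forall>X. X \<subseteq> A \<and> countable X \<and> infinite X \<longrightarrow> (\<exists>n. \<exists>\<beta>\<in>Field \<kappa>. X \<subseteq> ?K n \<beta>))"
    by (rule assms(4)[unfolded CP_omega_def, rule_format, OF omega_covering_matrix_rho[OF assms(1) walk]])
  then obtain A where A: "A \<subseteq> Field \<kappa>" "unbounded_in \<kappa> (Field \<kappa>) A"
    and cov: "\<forall>X. X \<subseteq> A \<and> countable X \<and> infinite X \<longrightarrow> (\<exists>n. \<exists>\<beta>\<in>Field \<kappa>. X \<subseteq> ?K n \<beta>)"
    by (elim exE conjE)
  have "\<forall>x\<in>Field \<kappa>. \<exists>a\<in>A. x \<in> underS \<kappa> a"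
    using A(2) unfolding unbounded_in_def by blast
  then obtain X where X: "X \<subseteq> A \<and> countable X \<and> infinite X"
    and uncov: "\<forall>n. \<forall>b\<in>Field \<kappa>. \<not> X \<subseteq> ?K n b"
    using W.uncovered_countable_subset[OF A(1)] by blast
  obtain n b where "b \<in> Field \<kappa>" "X \<subseteq> ?K n b"
    using cov[rule_format, OF X] by (elim exE bexE)
  then show False by (rule uncov[rule_format, THEN notE])
qed

end
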